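(* For every $n\in\mathbb{N}$, $$\sum_{k\in\mathrm{Reg}_n}\gcd(k-1,n)=\sum_{d\,\|\,n}\phi(d)\tau(d)=\prod_{p^{\nu}\,\|\,n}\left(p^{\nu-1}(p-1)(\nu+1)+1\right).$$
   Context: $\mathbb{N}=\{1,2,\ldots\}$. An integer $k$ is called regular (mod $n$) if there exists $x\in\mathbb{Z}$ with $k^2x\equiv k\pmod n$, and $\mathrm{Reg}_n=\{k\in\mathbb{N}:1\le k\le n,\ k\text{ is regular (mod }n)\}$. $d\,\|\,n$ means that $d$ is a unitary divisor of $n$, i.e. $d\ge1$, $d\mid n$ and $\gcd(d,n/d)=1$; the product over $p^{\nu}\,\|\,n$ runs over the prime powers $p^\nu$ ($\nu\ge1$) in the prime factorization of $n$ (empty product $=1$). $\phi$ is Euler's totient function, $\tau(n)$ is the number of positive divisors of $n$, and $\gcd(0,n)=n$. *)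

theory Defs
  imports "HOL-Number_Theory.Number_Theory"
begin

definition regular_mod :: "nat \<Rightarrow> int \<Rightarrow> bool" where
  "regular_mod n k \<longleftrightarrow> (\<exists>x::int. [k\<^sup>2 * x = k] (mod int n))"

definition Reg :: "nat \<Rightarrow> nat set" where
  "Reg n = {k. 1 \<le> k \<and> k \<le> n \<and> regular_mod n (int k)}"

definition unitary_divisor :: "nat \<Rightarrow> nat \<Rightarrow> bool" where
  "unitary_divisor d n \<longleftrightarrow> 1 \<le> d \<and> d dvd n \<and> gcd d (n div d) = 1"

definition divisor_count :: "nat \<Rightarrow> nat" where
  "divisor_count n = card {d. d dvd n}"

end

theory Submission
  imports Defs
begin

text \<open>
  All three expressions are multiplicative in n, the first one by the Chinese remainder theorem,
  so it suffices to compare them at a prime power q = p^v.  The regular residues modulo q are 0 and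
  the units.  The residue 0 contributes gcd(q - 1, q) = 1.  The units contribute Menon's sum, which
  is evaluated by writing the gcd as the sum of the totients of its divisors: each of the v + 1
  divisors of q contributes the totient of q.
\<close>

section \<open>Multiplicative functions and divisors of coprime products\<close>

text \<open>Powers of distinct primes are coprime, so the prime powers in \<open>n\<close> can be
  split off one at a time. This is applied once to each of the two sums.\<close>

lemma multiplicative_eq_prod_prime_powers:
  fixes f :: "nat \<Rightarrow> 'a::comm_monoid_mult"
  assumes one: "f 1 = 1"
    and mult: "\<And>m n. m > 0 \<Longrightarrow> n > 0 \<Longrightarrow> coprime m n \<Longrightarrow> f (m * n) = f m * f n"
    and "n > 0"
  shows "f n = (\<Prod>p\<in>prime_factors n. f (p ^ multiplicity p n))"
proof -
  \<comment> \<open>Passing from \<open>prime_factors n\<close> to an arbitrary finite subset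
    \<open>S\<close> makes induction on the set possible.\<close>
  have "f (\<Prod>p\<in>S. p ^ multiplicity p n) = (\<Prod>p\<in>S. f (p ^ multiplicity p n))"
    if "finite S" "S \<subseteq> prime_factors n" for S
    using that
  proof (induction S rule: finite_induct)
    case empty
    then show ?case using one by simp
  next
    case (insert p S)
    have "coprime (p ^ multiplicity p n) (\<Prod>q\<in>S. q ^ multiplicity q n)"
      using insert by (intro prod_coprime_right)
        (auto intro!: primes_coprime coprime_power_left_iff[THEN iffD2]
          coprime_power_right_iff[THEN iffD2])
    moreover have "p ^ multiplicity p n > 0" "(\<Prod>q\<in>S. q ^ multiplicity q n) > 0"
      using insert by (auto intro!: prod_pos prime_gt_0_nat)
    ultimately show ?case
      using insert mult by simp
  qed
  from this[of "prime_factors n"] show ?thesis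
    using prime_factorization_nat[OF \<open>n > 0\<close>] by simp
qed

text \<open>A divisor of \<open>m * n\<close> splits into a divisor of \<open>m\<close> and a
  divisor of \<open>n\<close>, each of which divides \<open>j\<close> when the product does.
  Coprimality gives the other divisibility.\<close>

lemma gcd_mult_right_coprime:
  fixes j m n :: nat
  assumes "coprime m n"
  shows "gcd j (m * n) = gcd j m * gcd j n"
proof (rule dvd_antisym)
  show "gcd j m * gcd j n dvd gcd j (m * n)"
    using assms by (intro gcd_greatest divides_mult mult_dvd_mono) (auto intro: coprime_divisors)
  show "gcd j (m * n) dvd gcd j m * gcd j n"
  proof -
    obtain b c where bc: "gcd j (m * n) = b * c" "b dvd m" "c dvd n"
      using division_decomp[of "gcd j (m * n)" m n] by auto
    then have "b * c dvd j" by (metis gcd_dvd1)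
    then have "b dvd j" "c dvd j" by (auto dest: dvd_mult_left dvd_mult_right)
    with bc show ?thesis by (simp add: mult_dvd_mono)
  qed
qed

lemma bij_betw_divisors_coprime:
  fixes m n :: nat
  assumes "coprime m n"
  shows "bij_betw (\<lambda>(a, b). a * b) ({a. a dvd m} \<times> {b. b dvd n}) {d. d dvd m * n}"
proof (rule bij_betw_byWitness[where f' = "\<lambda>d. (gcd d m, gcd d n)"])
  show "\<forall>x\<in>{a. a dvd m} \<times> {b. b dvd n}. (\<lambda>d. (gcd d m, gcd d n)) ((\<lambda>(a, b). a * b) x) = x"
  proof clarsimp
    fix a b assume ab: "a dvd m" "b dvd n"
    \<comment> \<open>Each factor is coprime to the opposite modulus and cancels from the gcd with
      it.\<close>
    then have "coprime b m" "coprime a n"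
      using assms coprime_divisors[of b n m m] coprime_divisors[of a m n n]
      by (simp_all add: coprime_commute)
    then show "gcd (a * b) m = a \<and> gcd (a * b) n = b"
      using ab gcd_mult_left_right_cancel[of m b a] gcd_mult_left_left_cancel[of n a b]
      by (auto simp: gcd_nat.absorb1 coprime_commute)
  qed
  show "\<forall>d\<in>{d. d dvd m * n}. (\<lambda>(a, b). a * b) (gcd d m, gcd d n) = d"
    by (auto simp: gcd_mult_right_coprime[OF assms, symmetric] gcd_nat.absorb1)
qed (auto intro: mult_dvd_mono)

lemma divisor_count_mult_coprime:
  assumes "coprime m n"
  shows "divisor_count (m * n) = divisor_count m * divisor_count n"
  using bij_betw_same_card[OF bij_betw_divisors_coprime[OF assms]]
  by (simp add: divisor_count_def card_cartesian_product)

lemma divisors_prime_power: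
  fixes p :: nat
  assumes "prime p"
  shows "{d. d dvd p ^ v} = (^) p ` {..v}"
  using divides_primepow_nat[OF assms] by auto

lemma inj_on_prime_power:
  fixes p :: nat
  assumes "prime p"
  shows "inj_on ((^) p) A"
  using assms prime_power_inj[of p] by (auto simp: inj_on_def)

lemma divisor_count_prime_power:
  assumes "prime p"
  shows "divisor_count (p ^ v) = v + 1"
  using assms by (simp add: divisor_count_def divisors_prime_power card_image inj_on_prime_power)

section \<open>Sums over unitary divisors\<close>

text \<open>With \<open>m = a * c\<close> and \<open>n = b * d\<close>, the cofactor of
  \<open>a * b\<close> is \<open>c * d\<close>. The mixed pairs \<open>a, d\<close> and
  \<open>b, c\<close> are coprime because \<open>m\<close> and \<open>n\<close> are, so only the
  pairs \<open>a, c\<close> and \<open>b, d\<close> matter.\<close>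

lemma unitary_divisor_mult_coprime_iff:
  assumes "coprime m n" "m > 0" "n > 0" "a dvd m" "b dvd n"
  shows "unitary_divisor (a * b) (m * n) \<longleftrightarrow> unitary_divisor a m \<and> unitary_divisor b n"
proof -
  from assms obtain c d where m: "m = a * c" and n: "n = b * d" by (auto elim!: dvdE)
  have ab: "a > 0" "b > 0" using assms m n by auto
  have "m * n = (a * b) * (c * d)" by (simp add: m n)
  then have "m * n div (a * b) = c * d" using ab by simp
  moreover have "m div a = c" "n div b = d" using ab m n by auto
  ultimately show ?thesis
    using assms(1) ab unfolding unitary_divisor_def m n coprime_iff_gcd_eq_1[symmetric]
    by (auto simp: coprime_commute)
qed

lemma sum_unitary_divisors_mult_coprime:
  fixes g :: "nat \<Rightarrow> 'a::comm_semiring_1"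
  assumes "coprime m n" "m > 0" "n > 0"
    and g: "\<And>a b. coprime a b \<Longrightarrow> g (a * b) = g a * g b"
  shows "(\<Sum>d | unitary_divisor d (m * n). g d) =
    (\<Sum>d | unitary_divisor d m. g d) * (\<Sum>d | unitary_divisor d n. g d)"
proof -
  let ?D = "{a. unitary_divisor a m} \<times> {b. unitary_divisor b n}"
  let ?f = "\<lambda>(a, b). a * b :: nat"
  have dvd: "a dvd n" if "unitary_divisor a n" for a n using that by (simp add: unitary_divisor_def)
  have "?f ` ?D = {d. unitary_divisor d (m * n)}"
  proof (intro equalityI subsetI)
    fix d assume "d \<in> ?f ` ?D"
    then show "d \<in> {d. unitary_divisor d (m * n)}"
      using dvd unitary_divisor_mult_coprime_iff[OF assms(1-3)] by auto
  next
    fix d assume d: "d \<in> {d. unitary_divisor d (m * n)}"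
    then have "d dvd m * n" using dvd by simp
    then obtain a b where ab: "a dvd m" "b dvd n" "d = a * b"
      using division_decomp[of d m n] by auto
    then show "d \<in> ?f ` ?D"
      using d unitary_divisor_mult_coprime_iff[OF assms(1-3)] by auto
  qed
  moreover have "inj_on ?f ?D"
    using bij_betw_imp_inj_on[OF bij_betw_divisors_coprime[OF assms(1)]]
    by (rule inj_on_subset) (use dvd in auto)
  ultimately have "bij_betw ?f ?D {d. unitary_divisor d (m * n)}"
    by (simp add: bij_betw_def)
  then have "(\<Sum>d | unitary_divisor d (m * n). g d) = (\<Sum>x\<in>?D. g (?f x))"
    by (rule sum.reindex_bij_betw[symmetric])
  also have "\<dots> = (\<Sum>(a, b)\<in>?D. g a * g b)"
    using assms(1) dvd by (intro sum.cong) (auto intro!: g coprime_divisors[OF _ _ assms(1)])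
  also have "\<dots> = (\<Sum>d | unitary_divisor d m. g d) * (\<Sum>d | unitary_divisor d n. g d)"
    by (simp add: sum_product sum.cartesian_product)
  finally show ?thesis .
qed

lemma unitary_divisors_prime_power:
  assumes "prime p"
  shows "{d. unitary_divisor d (p ^ v)} = {1, p ^ v}"
proof (intro equalityI subsetI)
  fix d assume "d \<in> {d. unitary_divisor d (p ^ v)}"
  then have d: "d dvd p ^ v" "coprime d (p ^ v div d)"
    unfolding unitary_divisor_def coprime_iff_gcd_eq_1 by auto
  then obtain i where i: "i \<le> v" "d = p ^ i"
    using divides_primepow_nat[OF assms] by auto
  have "p ^ v div d = p ^ (v - i)"
    unfolding i(2) using i(1) assms by (intro power_diff[symmetric]) auto
  \<comment> \<open>Two powers of \<open>p\<close> are coprime only if one of the exponents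
    vanishes.\<close>
  with d(2) i(2) assms have "i = 0 \<or> v - i = 0" by auto
  then show "d \<in> {1, p ^ v}" using i by auto
next
  have "p ^ v > 0" using assms by (simp add: prime_gt_0_nat)
  moreover fix d assume "d \<in> {1, p ^ v}"
  ultimately show "d \<in> {d. unitary_divisor d (p ^ v)}"
    by (auto simp: unitary_divisor_def)
qed

lemma sum_totient_divisor_count_prime_power:
  assumes "prime p" "v > 0"
  shows "(\<Sum>d | unitary_divisor d (p ^ v). totient d * divisor_count d) =
    p ^ (v - 1) * (p - 1) * (v + 1) + 1"
proof -
  \<comment> \<open>Since \<open>v > 0\<close>, the two unitary divisors are distinct; the divisor 1
    yields the summand 1.\<close>
  have one: "1 \<notin> {p ^ v}" using assms by (simp del: One_nat_def)
  have "(\<Sum>d | unitary_divisor d (p ^ v). totient d * divisor_count d) =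
      totient 1 * divisor_count 1 + totient (p ^ v) * divisor_count (p ^ v)"
    unfolding unitary_divisors_prime_power[OF assms(1)] by (subst sum.insert[OF _ one]) simp_all
  moreover have "divisor_count 1 = 1" by (simp add: divisor_count_def)
  ultimately show ?thesis
    using assms by (simp add: divisor_count_prime_power totient_prime_power)
qed

section \<open>Regular residues and multiplicativity of the gcd sum\<close>

text \<open>With j = k - 1 the representatives become the least nonnegative residues, on which the
  Chinese remainder bijection is given by reduction modulo the factors.\<close>
lemma sum_reg_shift:
  assumes "n > 0"
  shows "(\<Sum>k\<in>Reg n. gcd (k - 1) n) = (\<Sum>j | j < n \<and> regular_mod n (int j + 1). gcd j n)"
  by (rule sum.reindex_bij_witness[of _ Suc "\<lambda>k. k - 1"]) (auto simp: Reg_def add.commute)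

lemma regular_mod_cong:
  assumes "[a = b] (mod int n)"
  shows "regular_mod n a \<longleftrightarrow> regular_mod n b"
proof -
  have "[a\<^sup>2 * x = a] (mod int n) \<longleftrightarrow> [b\<^sup>2 * x = b] (mod int n)" for x
    using assms by (meson cong_pow cong_scalar_right cong_sym cong_trans)
  then show ?thesis by (simp add: regular_mod_def)
qed

text \<open>A witness modulo the product also serves modulo each factor. Conversely, the Chinese
  remainder theorem glues two witnesses into one.\<close>

lemma regular_mod_mult_coprime_iff:
  assumes "coprime m n"
  shows "regular_mod (m * n) k \<longleftrightarrow> regular_mod m k \<and> regular_mod n k"
proof
  assume "regular_mod (m * n) k"
  then show "regular_mod m k \<and> regular_mod n k"
    unfolding regular_mod_def by (metis cong_dvd_modulus dvd_triv_left dvd_triv_right of_nat_mult)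
next
  assume "regular_mod m k \<and> regular_mod n k"
  then obtain x y where xy: "[k\<^sup>2 * x = k] (mod int m)" "[k\<^sup>2 * y = k] (mod int n)"
    by (auto simp: regular_mod_def)
  obtain z where z: "[z = x] (mod int m)" "[z = y] (mod int n)"
    using binary_chinese_remainder_int[of "int m" "int n" x y] assms by auto
  have "[k\<^sup>2 * z = k] (mod int m)" "[k\<^sup>2 * z = k] (mod int n)"
    using xy z by (meson cong_scalar_left cong_trans)+
  then show "regular_mod (m * n) k"
    using assms unfolding regular_mod_def by (auto intro!: exI[of _ z] coprime_cong_mult)
qed

lemma sum_regular_mult_coprime:
  assumes "coprime m n" "m > 0" "n > 0"
  shows "(\<Sum>j | j < m * n \<and> regular_mod (m * n) (int j + 1). gcd j (m * n)) =
    (\<Sum>j | j < m \<and> regular_mod m (int j + 1). gcd j m) *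
    (\<Sum>j | j < n \<and> regular_mod n (int j + 1). gcd j n)"
proof -
  let ?R = "\<lambda>n. {j. j < n \<and> regular_mod n (int j + 1)}"
  let ?f = "\<lambda>j. (j mod m, j mod n)"
  have reg_mod: "regular_mod d (int (j mod d) + 1) \<longleftrightarrow> regular_mod d (int j + 1)" for j d
    by (rule regular_mod_cong) (auto simp: cong_def zmod_int mod_simps)
  have "bij_betw ?f (?R (m * n)) (?R m \<times> ?R n)"
    unfolding bij_betw_def
  proof
    show "inj_on ?f (?R (m * n))"
    proof (rule inj_onI)
      fix x y assume "x \<in> ?R (m * n)" "y \<in> ?R (m * n)" "?f x = ?f y"
      then show "x = y"
        \<comment> \<open>Both \<open>x\<close> and \<open>y\<close> solve the system with
          right-hand sides \<open>x\<close> and \<open>x\<close>, whose solution below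
          \<open>m * n\<close> is unique.\<close>
        using binary_chinese_remainder_unique_nat[OF assms(1), of x x] assms
        by (auto simp: cong_def)
    qed
    show "?f ` ?R (m * n) = ?R m \<times> ?R n"
    proof (intro equalityI subsetI)
      fix x assume "x \<in> ?f ` ?R (m * n)"
      then show "x \<in> ?R m \<times> ?R n"
        using assms reg_mod by (auto simp: regular_mod_mult_coprime_iff)
    next
      fix x assume "x \<in> ?R m \<times> ?R n"
      then obtain a b where x: "x = (a, b)" "a \<in> ?R m" "b \<in> ?R n" by auto
      obtain j where j: "j < m * n" "[j = a] (mod m)" "[j = b] (mod n)"
        using binary_chinese_remainder_unique_nat[OF assms(1), of a b] assms by auto
      then have ab: "j mod m = a" "j mod n = b" using x by (auto simp: cong_def)
      then have "j \<in> ?R (m * n)"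
        using j x reg_mod[where j = j] by (auto simp: regular_mod_mult_coprime_iff[OF assms(1)])
      then show "x \<in> ?f ` ?R (m * n)" using x ab by auto
    qed
  qed
  then have "(\<Sum>x\<in>?R m \<times> ?R n. gcd (fst x) m * gcd (snd x) n) =
      (\<Sum>j\<in>?R (m * n). gcd (j mod m) m * gcd (j mod n) n)"
    by (subst sum.reindex_bij_betw[symmetric]) auto
  also have "\<dots> = (\<Sum>j\<in>?R (m * n). gcd j (m * n))"
    using assms by (simp add: gcd_mult_right_coprime)
  finally show ?thesis
    by (simp add: sum_product sum.cartesian_product case_prod_beta)
qed

section \<open>Prime power moduli and Menon's sum\<close>

text \<open>Regularity says that \<open>p ^ v\<close> divides \<open>k * (k * x - 1)\<close> for
  some \<open>x\<close>. If \<open>p\<close> divides \<open>k\<close>, the second factor is coprime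
  to \<open>p\<close>, so \<open>p ^ v\<close> divides \<open>k\<close>. Conversely, a unit takes
  its inverse as witness and a multiple of \<open>p ^ v\<close> takes 0.\<close>

lemma regular_mod_prime_power_iff:
  assumes "prime p"
  shows "regular_mod (p ^ v) (int k) \<longleftrightarrow> \<not> p dvd k \<or> p ^ v dvd k"
proof (intro iffI disjCI)
  assume "regular_mod (p ^ v) (int k)" and dvd: "\<not> p ^ v dvd k"
  then obtain x where "[(int k)\<^sup>2 * x = int k] (mod int (p ^ v))"
    by (auto simp: regular_mod_def)
  then have *: "int (p ^ v) dvd int k * (int k * x - 1)"
    by (simp add: cong_iff_dvd_diff power2_eq_square algebra_simps)
  show "\<not> p dvd k"
  proof
    assume "p dvd k"
    then have "int p dvd int k * x" by simp
    moreover have "\<not> int p dvd 1" using assms by auto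
    ultimately have "\<not> int p dvd int k * x - 1"
      using dvd_diff_right_iff[of "int p" "int k * x" 1] by blast
    moreover have "prime (int p)" using assms by simp
    ultimately have "coprime (int p) (int k * x - 1)" by (rule prime_imp_coprime[rotated])
    then have "coprime (int (p ^ v)) (int k * x - 1)" by simp
    with * have "int (p ^ v) dvd int k" by (simp add: coprime_dvd_mult_left_iff)
    with dvd show False by (simp only: int_dvd_int_iff)
  qed
next
  assume "\<not> p dvd k \<or> p ^ v dvd k"
  then show "regular_mod (p ^ v) (int k)"
  proof
    assume "\<not> p dvd k"
    then have "coprime k p"
      using assms prime_imp_coprime[of p k] by (simp add: coprime_commute)
    then have "coprime (int k) (int (p ^ v))" by simp
    then obtain x where "[int k * x = 1] (mod int (p ^ v))"
      using cong_solve_coprime_int by blast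
    then have "[int k * (int k * x) = int k * 1] (mod int (p ^ v))"
      by (rule cong_scalar_left)
    then show ?thesis
      by (auto simp: regular_mod_def power2_eq_square mult.assoc)
  next
    assume "p ^ v dvd k"
    then have "int (p ^ v) dvd int k" by (simp only: int_dvd_int_iff)
    then have "[(int k)\<^sup>2 * 0 = int k] (mod int (p ^ v))"
      by (simp add: cong_iff_dvd_diff)
    then show ?thesis unfolding regular_mod_def by blast
  qed
qed

lemma card_multiples_less:
  fixes d m :: nat
  assumes "d > 0"
  shows "card {j. j < d * m \<and> d dvd j} = m"
proof -
  have "{j. j < d * m \<and> d dvd j} = (*) d ` {..<m}"
    using assms by (auto elim!: dvdE)
  then show ?thesis using assms by (simp add: card_image inj_on_def)
qed

text \<open>The product is independent of \<open>i\<close>, which makes all divisors of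
  \<open>p ^ v\<close> contribute equally to Menon's sum. For \<open>i > 0\<close>,
  \<open>p dvd j\<close> already forces \<open>\<not> p dvd Suc j\<close>, leaving the
  \<open>p ^ (v - i)\<close> multiples of \<open>p ^ i\<close>.\<close>

lemma card_units_multiples_prime_power:
  assumes p: "prime p" and "v > 0" "i \<le> v"
  shows "totient (p ^ i) * card {j. j < p ^ v \<and> \<not> p dvd Suc j \<and> p ^ i dvd j} = totient (p ^ v)"
proof (cases "i = 0")
  case True
  have "card {j. j < p ^ v \<and> \<not> p dvd Suc j} = card (totatives (p ^ v))"
  \<comment> \<open>Totatives are taken in the range from 1 to \<open>p ^ v\<close>, while
    \<open>j\<close> starts at 0.\<close>
  proof (rule bij_betw_same_card[of Suc], rule bij_betwI[where g = "\<lambda>k. k - 1"])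
    show "Suc \<in> {j. j < p ^ v \<and> \<not> p dvd Suc j} \<rightarrow> totatives (p ^ v)"
      using p by (auto simp: in_totatives_iff prime_imp_coprime coprime_commute)
    show "(\<lambda>k. k - 1) \<in> totatives (p ^ v) \<rightarrow> {j. j < p ^ v \<and> \<not> p dvd Suc j}"
      using p \<open>v > 0\<close> by (auto simp: in_totatives_iff coprime_absorb_right)
  qed (auto simp: in_totatives_iff)
  then show ?thesis using True by (simp add: totient_def)
next
  case False
  then have dvd: "p dvd p ^ i" by (simp add: dvd_power)
  have "\<not> p dvd Suc j" if "p ^ i dvd j" for j
  proof
    assume "p dvd Suc j"
    moreover have "p dvd j" using dvd that by (rule dvd_trans)
    ultimately have "p dvd Suc j - j" by (rule dvd_diff_nat)
    then show False using p by simp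
  qed
  then have "{j. j < p ^ v \<and> \<not> p dvd Suc j \<and> p ^ i dvd j} =
      {j. j < p ^ i * p ^ (v - i) \<and> p ^ i dvd j}"
    using assms by (auto simp flip: power_add)
  then have "card {j. j < p ^ v \<and> \<not> p dvd Suc j \<and> p ^ i dvd j} = p ^ (v - i)"
    using p card_multiples_less[of "p ^ i"] by (simp add: prime_gt_0_nat)
  moreover have "p ^ (i - 1) * p ^ (v - i) = p ^ (v - 1)"
    using assms False by (simp flip: power_add)
  ultimately show ?thesis
    using assms False by (simp add: totient_prime_power algebra_simps)
qed

lemma sum_gcd_units_prime_power:
  assumes p: "prime p" and "v > 0"
  shows "(\<Sum>j | j < p ^ v \<and> \<not> p dvd Suc j. gcd j (p ^ v)) = totient (p ^ v) * (v + 1)"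
proof -
  let ?J = "{j. j < p ^ v \<and> \<not> p dvd Suc j}"
  have gcd: "gcd j (p ^ v) = (\<Sum>i\<le>v. if p ^ i dvd j then totient (p ^ i) else 0)" for j
  proof -
    have "{d. d dvd gcd j (p ^ v)} = (^) p ` {i \<in> {..v}. p ^ i dvd j}"
      using divisors_prime_power[OF p, of v] by auto
    then have "gcd j (p ^ v) = (\<Sum>d\<in>(^) p ` {i \<in> {..v}. p ^ i dvd j}. totient d)"
      \<comment> \<open>Gauss's identity: the totients of the divisors of a number sum to that
        number.\<close>
      using totient_divisor_sum[of "gcd j (p ^ v)"] by simp
    also have "\<dots> = (\<Sum>i\<in>{i \<in> {..v}. p ^ i dvd j}. totient (p ^ i))"
      using inj_on_prime_power[OF p] by (simp add: sum.reindex)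
    also have "\<dots> = (\<Sum>i\<le>v. if p ^ i dvd j then totient (p ^ i) else 0)"
      by (rule sum.inter_filter) simp
    finally show ?thesis .
  qed
  have "(\<Sum>j\<in>?J. gcd j (p ^ v)) = (\<Sum>i\<le>v. \<Sum>j\<in>?J. if p ^ i dvd j then totient (p ^ i) else 0)"
    unfolding gcd by (rule sum.swap)
  also have "\<dots> = (\<Sum>i\<le>v. totient (p ^ i) * card {j. j < p ^ v \<and> \<not> p dvd Suc j \<and> p ^ i dvd j})"
    by (simp add: sum.inter_filter[symmetric] conj_assoc mult.commute)
  also have "\<dots> = (\<Sum>i\<le>v. totient (p ^ v))"
    using card_units_multiples_prime_power[OF assms] by (intro sum.cong) auto
  finally show ?thesis by simp
qed

lemma sum_regular_prime_power:
  assumes p: "prime p" and "v > 0"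
  shows "(\<Sum>j | j < p ^ v \<and> regular_mod (p ^ v) (int j + 1). gcd j (p ^ v)) =
    p ^ (v - 1) * (p - 1) * (v + 1) + 1"
proof -
  let ?J = "{j. j < p ^ v \<and> \<not> p dvd Suc j}"
  have pos: "p ^ v > 0" using p by (simp add: prime_gt_0_nat)
  \<comment> \<open>\<open>Suc j\<close> lies between 1 and \<open>p ^ v\<close>, so the residue 0
    is represented by \<open>p ^ v\<close> itself.\<close>
  have last: "p ^ v dvd Suc j \<longleftrightarrow> j = p ^ v - 1" if "j < p ^ v" for j
    using that pos by (auto dest: dvd_imp_le)
  have "regular_mod (p ^ v) (int j + 1) \<longleftrightarrow> \<not> p dvd Suc j \<or> p ^ v dvd Suc j" for j
    using regular_mod_prime_power_iff[OF p, of v "Suc j"] by (simp add: add.commute)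
  then have "{j. j < p ^ v \<and> regular_mod (p ^ v) (int j + 1)} = insert (p ^ v - 1) ?J"
    using last pos by auto
  \<comment> \<open>As \<open>v > 0\<close>, \<open>p\<close> divides \<open>p ^ v\<close>, so this
    index is not among the units and is counted separately. Its gcd, taken between consecutive
    numbers, gives the final \<open>+ 1\<close>.\<close>
  moreover have "p ^ v - 1 \<notin> ?J"
    using pos \<open>v > 0\<close> by (simp add: dvd_power)
  moreover have "gcd (p ^ v - 1) (p ^ v) = 1"
    using pos by (intro coprime_imp_gcd_eq_1 coprime_diff_one_left_nat)
  ultimately show ?thesis
    using sum_gcd_units_prime_power[OF assms] assms by (simp add: totient_prime_power)
qed

theorem proposition5p3p1:
  fixes n :: nat
  assumes "n \<ge> 1"
  shows "(\<Sum>k\<in>Reg n. gcd (k - 1) n) = (\<Sum>d | unitary_divisor d n. totient d * divisor_count d)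
    \<and> (\<Sum>d | unitary_divisor d n. totient d * divisor_count d) =
      (\<Prod>p\<in>prime_factors n.
        p ^ (multiplicity p n - 1) * (p - 1) * (multiplicity p n + 1) + 1)"
proof -
  let ?A = "\<lambda>n. \<Sum>j | j < n \<and> regular_mod n (int j + 1). gcd j n"
  let ?B = "\<lambda>n. \<Sum>d | unitary_divisor d n. totient d * divisor_count d"
  let ?C = "\<Prod>p\<in>prime_factors n. p ^ (multiplicity p n - 1) * (p - 1) * (multiplicity p n + 1) + 1"
  have n: "n > 0" using assms by simp
  have pp: "prime p" "multiplicity p n > 0" if "p \<in> prime_factors n" for p
    using that by (auto simp: prime_factors_multiplicity)
  \<comment> \<open>Modulo 1 the only residue is 0, and \<open>gcd 0 1 = 1\<close> gives the
    normalisation at 1.\<close>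
  have "{j. j < 1 \<and> regular_mod 1 (int j + 1)} = {0::nat}"
    by (auto simp: regular_mod_def)
  then have "?A 1 = 1" by simp
  then have "?A n = (\<Prod>p\<in>prime_factors n. ?A (p ^ multiplicity p n))"
    using sum_regular_mult_coprime n by (intro multiplicative_eq_prod_prime_powers) auto
  also have "\<dots> = ?C"
    using sum_regular_prime_power pp by (intro prod.cong) auto
  finally have A: "?A n = ?C" .
  have "{d. unitary_divisor d 1} = {1}"
    by (auto simp: unitary_divisor_def)
  then have "?B 1 = 1" by (simp add: divisor_count_def)
  moreover have "?B (a * b) = ?B a * ?B b" if "a > 0" "b > 0" "coprime a b" for a b
    using that by (intro sum_unitary_divisors_mult_coprime)
      (auto simp: totient_mult_coprime divisor_count_mult_coprime)
  ultimately have "?B n = (\<Prod>p\<in>prime_factors n. ?B (p ^ multiplicity p n))"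
    using n by (intro multiplicative_eq_prod_prime_powers) auto
  also have "\<dots> = ?C"
    using sum_totient_divisor_count_prime_power pp by (intro prod.cong) auto
  finally have "?B n = ?C" .
  \<comment> \<open>Both sums have been shown equal to \<open>?C\<close>, so they agree with each
    other; the shift of index restores the sum over \<open>Reg n\<close>.\<close>
  with A show ?thesis using sum_reg_shift[OF n] by simp
qed

end
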